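(* Let $\mathbf{F}$ be a field of characteristic $3$. Then any two elements of $\mathfrak{sl}_3(\mathbf{F})$ generate a Lie algebra of dimension at most $4$ over $\mathbf{F}$. In particular, $\mathfrak{sl}_3(\mathbf{F})$ is not $2$-generated. It is, however, $3$-generated.
   Context: $\mathfrak{sl}_3(\mathbf{F})$ is the Lie algebra over $\mathbf{F}$ of traceless $3\times 3$ matrices with bracket $[x,y]=xy-yx$. The Lie algebra generated by some elements is the smallest Lie subalgebra over $\mathbf{F}$ (an $\mathbf{F}$-subspace closed under the bracket) containing them. A Lie algebra over $\mathbf{F}$ is $k$-generated if it is generated by some $k$ of its elements. The field $\mathbf{F}$ may be finite or infinite. *)

theory Defs
  imports "HOL-Analysis.Analysis"
begin

text \<open>
  HOL-Analysis provides the vector space structure over an arbitrary field only on vectors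
  (\<open>*s\<close>, prefix \<open>vec\<close>); \<open>*\<^sub>R\<close> covers only real scalars.  The analogous entrywise structure on
  matrices is set up here.  As the space is finite-dimensional, \<open>matrix_space.dim\<close> never takes its
  default value \<open>0\<close> for a set of infinite dimension.
\<close>

definition matrix_scale :: "'a::times \<Rightarrow> 'a^'n^'m \<Rightarrow> 'a^'n^'m"
  where "matrix_scale c A = (\<chi> i j. c * A $ i $ j)"

definition matrix_units :: "('a::zero_neq_one^'n^'m) set"
  where "matrix_units = (\<lambda>(i, j). axis i (axis j 1)) ` UNIV"

lemma matrix_unit_nth:
  "axis i (axis j (1::'a::zero_neq_one)) $ k $ l = (if k = i \<and> l = j then 1 else 0)"
  by (auto simp: axis_def)

global_interpretation matrix_space:
  vector_space "matrix_scale :: 'a::field \<Rightarrow> 'a^'n^'m \<Rightarrow> 'a^'n^'m"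
  by unfold_locales (simp_all add: matrix_scale_def vec_eq_iff algebra_simps)

lemma matrix_sum_units:
  fixes u :: "'m::finite \<times> 'n::finite \<Rightarrow> 'a::field"
  shows "(\<Sum>p\<in>UNIV. matrix_scale (u p) (case p of (i, j) \<Rightarrow> axis i (axis j 1)))
          = (\<chi> i j. u (i, j))"
proof -
  have "(\<Sum>p\<in>UNIV. u p * ((case p of (i, j) \<Rightarrow> axis i (axis j (1::'a))) $ k $ l)) = u (k, l)"
    for k l
  proof -
    have "(\<Sum>p\<in>UNIV. u p * ((case p of (i, j) \<Rightarrow> axis i (axis j (1::'a))) $ k $ l))
        = (\<Sum>p\<in>UNIV. if p = (k, l) then u p else 0)"
      by (rule sum.cong) (auto simp: matrix_unit_nth split: if_splits)
    then show ?thesis by simp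
  qed
  then show ?thesis
    by (simp add: vec_eq_iff matrix_scale_def)
qed

lemma inj_matrix_units:
  "inj (\<lambda>(i, j). axis i (axis j (1::'a::zero_neq_one)) :: 'a^'n^'m)"
proof (rule injI, clarify)
  fix i k :: 'm and j l :: 'n
  assume "axis i (axis j (1::'a)) = axis k (axis l 1)"
  then have "axis i (axis j (1::'a)) $ i $ j = axis k (axis l 1) $ i $ j" by simp
  then show "i = k \<and> j = l" by (simp add: matrix_unit_nth split: if_splits)
qed

global_interpretation matrix_space:
  finite_dimensional_vector_space
    "matrix_scale :: 'a::field \<Rightarrow> 'a^'n^'m \<Rightarrow> 'a^'n^'m" matrix_units
proof
  let ?e = "\<lambda>(i, j). axis i (axis j (1::'a)) :: 'a^'n^'m"
  show "finite (matrix_units :: ('a^'n^'m) set)"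
    by (simp add: matrix_units_def)
  show "matrix_space.independent (matrix_units :: ('a^'n^'m) set)"
  proof (rule matrix_space.independent_if_scalars_zero)
    show "finite (matrix_units :: ('a^'n^'m) set)"
      by (simp add: matrix_units_def)
    fix f :: "'a^'n^'m \<Rightarrow> 'a" and x :: "'a^'n^'m"
    assume 0: "(\<Sum>x\<in>matrix_units. matrix_scale (f x) x) = 0" and x: "x \<in> matrix_units"
    have "(\<Sum>p\<in>UNIV. matrix_scale ((f \<circ> ?e) p) (?e p)) = 0"
      using 0 unfolding matrix_units_def by (subst (asm) sum.reindex[OF inj_matrix_units]) (simp add: o_def)
    then have "(\<chi> i j. (f \<circ> ?e) (i, j)) = 0"
      by (simp only: matrix_sum_units)
    with x show "f x = 0"
      by (auto simp: matrix_units_def vec_eq_iff)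
  qed
  show "matrix_space.span (matrix_units :: ('a^'n^'m) set) = UNIV"
  proof (intro equalityI subsetI UNIV_I)
    fix A :: "'a^'n^'m"
    have "A = (\<Sum>p\<in>UNIV. matrix_scale (case p of (i, j) \<Rightarrow> A $ i $ j) (?e p))"
      by (simp only: matrix_sum_units) simp
    also have "\<dots> \<in> matrix_space.span matrix_units"
      by (intro matrix_space.span_sum matrix_space.span_scale matrix_space.span_base)
         (auto simp: matrix_units_def)
    finally show "A \<in> matrix_space.span matrix_units" .
  qed
qed

definition lie_bracket :: "'a::ring_1^'n^'n \<Rightarrow> 'a^'n^'n \<Rightarrow> 'a^'n^'n"
  where "lie_bracket x y = x ** y - y ** x"

definition sl :: "('a::field^'n^'n) set"
  where "sl = {A. trace A = 0}"

definition lie_subalgebra :: "('a::field^'n^'n) set \<Rightarrow> bool"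
  where "lie_subalgebra L \<longleftrightarrow>
    matrix_space.subspace L \<and> (\<forall>x\<in>L. \<forall>y\<in>L. lie_bracket x y \<in> L)"

text \<open>
  The smallest Lie subalgebra is formed among all square matrices.  For \<open>S \<subseteq> sl\<close> it is the same as
  the smallest one inside \<open>sl\<close>, by \<open>lie_generated_subset_sl\<close> below.
\<close>

definition lie_generated :: "('a::field^'n^'n) set \<Rightarrow> ('a^'n^'n) set"
  where "lie_generated S = lie_subalgebra hull S"

lemma lie_subalgebra_lie_generated: "lie_subalgebra (lie_generated S)"
  unfolding lie_generated_def
  by (rule hull_in) (auto simp: lie_subalgebra_def intro: matrix_space.subspace_Inter)

lemma lie_subalgebra_sl: "lie_subalgebra (sl :: ('a::field^'n^'n) set)"
proof -
  have "trace (matrix_scale c A) = c * trace A" for c and A :: "'a^'n^'n"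
    by (simp add: trace_def matrix_scale_def sum_distrib_left)
  moreover have "trace (lie_bracket A B) = 0" for A B :: "'a^'n^'n"
    by (simp add: lie_bracket_def trace_sub trace_mul_sym[of A B])
  ultimately show ?thesis
    by (simp add: lie_subalgebra_def sl_def matrix_space.subspace_def trace_add)
       (simp add: trace_def)
qed

lemma lie_generated_subset_sl: "S \<subseteq> sl \<Longrightarrow> lie_generated S \<subseteq> sl"
  unfolding lie_generated_def by (rule hull_minimal[of _ _ lie_subalgebra, OF _ lie_subalgebra_sl])

text \<open>
  The \<open>k\<close> generators form a family, so repetitions are allowed and a \<open>k\<close>-generated Lie algebra
  is also \<open>Suc k\<close>-generated.
\<close>

definition k_generated :: "nat \<Rightarrow> ('a::field^'n^'n) set \<Rightarrow> bool"
  where "k_generated k L \<longleftrightarrow>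
    (\<exists>xs. length xs = k \<and> set xs \<subseteq> L \<and> lie_generated (set xs) = L)"

end

theory Submission
  imports Defs
begin

text \<open>
  The bound of \<open>4\<close> comes from the Cayley-Hamilton theorem.  For a traceless \<open>3 \<times> 3\<close> matrix \<open>x\<close> it
  says \<open>x\<^sup>3 = e x + d\<close>, where the scalars \<open>e\<close> and \<open>d\<close> are quadratic and cubic in \<open>x\<close>.
  The part of this identity that is quadratic in \<open>x\<close> and linear in \<open>y\<close> after replacing \<open>x\<close> by \<open>x + y\<close> expresses
  \<open>x\<^sup>2 y + x y x + y x\<^sup>2\<close> as a linear combination of \<open>x\<close>, \<open>y\<close> and \<open>1\<close>
  (\<open>polarized_Cayley_Hamilton_traceless_3\<close>).  In characteristic \<open>3\<close> the double commutator
  \<open>[x, [x, y]] = x\<^sup>2 y - 2 x y x + y x\<^sup>2\<close> is exactly that expression.  So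
  \<open>[x, [x, y]]\<close> and, by symmetry, \<open>[y, [x, y]]\<close> lie in the span of \<open>1\<close>, \<open>x\<close>, \<open>y\<close>; as \<open>1\<close> is central,
  the span of \<open>1\<close>, \<open>x\<close>, \<open>y\<close>, \<open>[x, y]\<close> is a Lie algebra.

  Two elements therefore cannot generate all of the traceless matrices, among which are the six
  independent off-diagonal matrix units.  Three elements can: the cycle of matrix units
  \<open>E\<^sub>1\<^sub>2\<close>, \<open>E\<^sub>2\<^sub>3\<close>, \<open>E\<^sub>3\<^sub>1\<close> has the other three off-diagonal units as its brackets,
  and the brackets of transposed units are the differences of diagonal ones.

  A conceptual reason for the bound: in characteristic \<open>3\<close> and modulo the centre, the traceless
  matrices are isomorphic to the traceless split octonions under the commutator.  Any two octonions
  lie in a unital subalgebra of dimension at most \<open>4\<close>, whose traceless part has dimension at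
  most \<open>3\<close>; the centre adds one more dimension.
\<close>

section \<open>The commutator of matrices\<close>

lemma matrix_scale_nth [simp]: "matrix_scale c A $ i $ j = c * A $ i $ j"
  by (simp add: matrix_scale_def)

lemma matrix_diff_ldistrib: "A ** (B - C) = A ** B - A ** C"
  and matrix_diff_rdistrib: "(B - C) ** A = B ** A - C ** A"
  for A B C :: "'a::ring_1^'n^'n"
  by (simp_all add: vec_eq_iff matrix_matrix_mult_def sum_subtractf algebra_simps)

lemma lie_bracket_add_left: "lie_bracket (a + b) c = lie_bracket a c + lie_bracket b c"
  and lie_bracket_add_right: "lie_bracket c (a + b) = lie_bracket c a + lie_bracket c b"
  by (simp_all add: lie_bracket_def vec_eq_iff matrix_matrix_mult_def sum.distrib algebra_simps)

lemma lie_bracket_scale_left: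
    "lie_bracket (matrix_scale k a) b = matrix_scale k (lie_bracket a b)"
  and lie_bracket_scale_right:
    "lie_bracket b (matrix_scale k a) = matrix_scale k (lie_bracket b a)"
  for a b :: "'a::comm_ring_1^'n^'n"
  by (simp_all add: lie_bracket_def vec_eq_iff matrix_matrix_mult_def sum_distrib_left
      right_diff_distrib mult_ac)

lemma lie_bracket_antisym: "lie_bracket a b = - lie_bracket b a"
  by (simp add: lie_bracket_def)

lemma lie_bracket_zero [simp]: "lie_bracket 0 a = 0" "lie_bracket a 0 = 0"
  by (simp_all add: lie_bracket_def vec_eq_iff matrix_matrix_mult_def)

lemma lie_bracket_self [simp]: "lie_bracket a a = 0"
  by (simp add: lie_bracket_def)

lemma lie_bracket_mat_1 [simp]: "lie_bracket (mat 1) a = 0" "lie_bracket a (mat 1) = 0"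
  by (simp_all add: lie_bracket_def)

lemma lie_subalgebra_span:
  assumes "\<And>a b. a \<in> S \<Longrightarrow> b \<in> S \<Longrightarrow> lie_bracket a b \<in> matrix_space.span S"
  shows "lie_subalgebra (matrix_space.span S)"
proof -
  have base: "lie_bracket a b \<in> matrix_space.span S"
    if "a \<in> S" "b \<in> matrix_space.span S" for a b
    using that(2)
    by (induction rule: matrix_space.span_induct_alt)
       (auto simp: lie_bracket_add_right lie_bracket_scale_right matrix_space.span_zero
         intro!: matrix_space.span_add matrix_space.span_scale assms that(1))
  have "lie_bracket a b \<in> matrix_space.span S"
    if "a \<in> matrix_space.span S" "b \<in> matrix_space.span S" for a b
    using that(1)
    by (induction rule: matrix_space.span_induct_alt)
       (auto simp: lie_bracket_add_left lie_bracket_scale_left matrix_space.span_zero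
         intro!: matrix_space.span_add matrix_space.span_scale base that(2))
  then show ?thesis
    by (simp add: lie_subalgebra_def)
qed

lemma lie_generated_minimal: "S \<subseteq> L \<Longrightarrow> lie_subalgebra L \<Longrightarrow> lie_generated S \<subseteq> L"
  unfolding lie_generated_def by (rule hull_minimal)

lemma subset_lie_generated: "S \<subseteq> lie_generated S"
  unfolding lie_generated_def by (rule hull_subset)

section \<open>Two traceless matrices in characteristic 3\<close>

text \<open>
  This is the component of the Cayley-Hamilton identity \<open>2 x\<^sup>3 = tr(x\<^sup>2) x + 2 det(x)\<close> that is quadratic
  in \<open>x\<close> and linear in \<open>y\<close>.  The factor \<open>2\<close> avoids a division in the coefficient of \<open>y\<close>.
\<close>

lemma polarized_Cayley_Hamilton_traceless_3:
  fixes x y :: "'a::comm_ring_1^3^3"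
  assumes "trace x = 0" "trace y = 0"
  shows "matrix_scale 2 (x ** x ** y + x ** y ** x + y ** x ** x)
    = matrix_scale (trace (x ** x)) y + matrix_scale (2 * trace (x ** y)) x
      + matrix_scale (2 * trace (x ** x ** y)) (mat 1)"
proof -
  have x: "x$3$3 = - x$1$1 - x$2$2" and y: "y$3$3 = - y$1$1 - y$2$2"
    using assms by (simp_all add: trace_def sum_3 eq_neg_iff_add_eq_0 algebra_simps)
  show ?thesis
    unfolding vec_eq_iff forall_3
    by (simp add: trace_def matrix_matrix_mult_def sum_3 mat_def x y)
       (simp add: algebra_simps)
qed

text \<open>
  When \<open>3 = 0\<close>, the middle coefficient of \<open>[x, [x, y]] = x\<^sup>2 y - 2 x y x + y x\<^sup>2\<close> is \<open>1\<close>, so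
  the polarized Cayley-Hamilton identity applies; the factor \<open>2\<close> there becomes the sign \<open>- 1\<close>.
\<close>

lemma double_bracket_char_3:
  fixes x y :: "'a::comm_ring_1^3^3"
  assumes three: "(3::'a) = 0" and "trace x = 0" "trace y = 0"
  shows "lie_bracket x (lie_bracket x y)
    = matrix_scale (- trace (x ** x)) y + matrix_scale (trace (x ** y)) x
      + matrix_scale (trace (x ** x ** y)) (mat 1)"
proof -
  have expand: "lie_bracket x (lie_bracket x y)
      = x ** x ** y - x ** y ** x - (x ** y ** x - y ** x ** x)"
    by (simp add: lie_bracket_def matrix_diff_ldistrib matrix_diff_rdistrib matrix_mul_assoc)
  \<comment> \<open>Entrywise, the double bracket is the negative of the left side \<open>2 (a + b + c)\<close> up to multiples of \<open>3\<close>,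
    by \<open>1 = 3 - 2\<close>.\<close>
  have "a - b - (b - c) = - t * v + s * u + r * w"
    if "2 * (a + b + c) = t * v + 2 * s * u + 2 * r * w" for a b c r s t u v w :: 'a
  proof -
    have "a - b - (b - c) = 3 * (a + c) - 2 * (a + b + c)"
      by (simp add: algebra_simps)
    also have "\<dots> = 3 * (a + c) - (t * v + 2 * s * u + 2 * r * w)"
      by (simp only: that)
    also have "\<dots> = - t * v + s * u + r * w + 3 * (a + c - s * u - r * w)"
      by (simp add: algebra_simps)
    finally show ?thesis
      by (simp add: three)
  qed
  then show ?thesis
    using polarized_Cayley_Hamilton_traceless_3[OF assms(2,3)]
    by (simp add: expand vec_eq_iff)
qed

lemma dim_lie_generated_pair_le_4:
  fixes x y :: "'a::field^3^3"
  assumes three: "(3::'a) = 0" and tr: "trace x = 0" "trace y = 0"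
  shows "matrix_space.dim (lie_generated {x, y}) \<le> 4"
proof -
  let ?S = "{mat 1, x, y, lie_bracket x y}"
  have xxy: "lie_bracket x (lie_bracket x y) \<in> matrix_space.span ?S"
    unfolding double_bracket_char_3[OF three tr]
    by (intro matrix_space.span_add matrix_space.span_scale matrix_space.span_base) auto
  have "lie_bracket y (lie_bracket y x) \<in> matrix_space.span ?S"
    unfolding double_bracket_char_3[OF three tr(2,1)]
    by (intro matrix_space.span_add matrix_space.span_scale matrix_space.span_base) auto
  then have yxy: "lie_bracket (lie_bracket x y) y \<in> matrix_space.span ?S"
    by (simp add: lie_bracket_def algebra_simps matrix_diff_ldistrib matrix_diff_rdistrib)
  have "lie_subalgebra (matrix_space.span ?S)"
  proof (rule lie_subalgebra_span)
    fix a b assume "a \<in> ?S" "b \<in> ?S"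
    moreover have "lie_bracket x y \<in> matrix_space.span ?S"
      by (simp add: matrix_space.span_base)
    ultimately show "lie_bracket a b \<in> matrix_space.span ?S"
      using xxy yxy lie_bracket_antisym[of y x] lie_bracket_antisym[of "lie_bracket x y" x]
        lie_bracket_antisym[of y "lie_bracket x y"]
      by (auto simp: matrix_space.span_zero matrix_space.span_neg)
  qed
  then have "lie_generated {x, y} \<subseteq> matrix_space.span ?S"
    by (rule lie_generated_minimal[rotated]) (auto intro: matrix_space.span_base)
  then have "matrix_space.dim (lie_generated {x, y}) \<le> card ?S"
    by (rule matrix_space.dim_le_card) simp
  also have "\<dots> \<le> 4"
    by (simp add: card_insert_if)
  finally show ?thesis .
qed

section \<open>Matrix units\<close>

lemma off_diagonal_unit_in_sl: "i \<noteq> j \<Longrightarrow> axis i (axis j 1) \<in> sl"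
  by (auto simp: sl_def trace_def matrix_unit_nth intro!: sum.neutral)

lemma lie_bracket_matrix_units:
  fixes i j k l :: "'n::finite"
  shows "lie_bracket (axis i (axis j (1::'a::ring_1))) (axis k (axis l 1))
    = (if j = k then axis i (axis l 1) else 0) - (if i = l then axis k (axis j 1) else 0)"
proof -
  have "axis i (axis j (1::'a)) ** axis k (axis l 1) = (if j = k then axis i (axis l 1) else 0)"
    for i j k l :: 'n
  proof -
    have "(\<Sum>m\<in>UNIV. axis i (axis j (1::'a)) $ p $ m * axis k (axis l 1) $ m $ q)
        = (\<Sum>m\<in>UNIV. if m = j then if j = k \<and> p = i \<and> q = l then 1 else 0 else 0)" for p q
      by (rule sum.cong) (auto simp: matrix_unit_nth)
    then show ?thesis
      by (simp add: vec_eq_iff matrix_matrix_mult_def) (simp add: matrix_unit_nth)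
  qed
  then show ?thesis
    by (auto simp: lie_bracket_def)
qed

text \<open>
  The off-diagonal units suffice: for \<open>n = 3\<close> there are six of them, more than two elements can
  generate.
\<close>

lemma dim_sl_ge:
  "CARD('n) * (CARD('n) - 1) \<le> matrix_space.dim (sl :: ('a::field^'n^'n) set)"
proof -
  let ?e = "\<lambda>(i, j). axis i (axis j (1::'a)) :: 'a^'n^'n"
  let ?P = "SIGMA i:(UNIV :: 'n set). - {i}"
  have "inj_on ?e ?P"
    using inj_matrix_units by (rule inj_on_subset) simp
  then have "card (?e ` ?P) = card ?P"
    by (rule card_image)
  also have "\<dots> = CARD('n) * (CARD('n) - 1)"
    by (simp add: Compl_eq_Diff_UNIV card_Diff_singleton)
  finally have card: "card (?e ` ?P) = CARD('n) * (CARD('n) - 1)" .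
  have "?e ` ?P \<subseteq> matrix_units"
    by (auto simp: matrix_units_def)
  then have "matrix_space.independent (?e ` ?P)"
    by (rule matrix_space.independent_mono[OF matrix_space.independent_Basis])
  moreover have "?e ` ?P \<subseteq> sl"
    by (auto intro!: off_diagonal_unit_in_sl)
  ultimately show ?thesis
    unfolding card[symmetric] by (intro matrix_space.independent_card_le_dim)
qed

section \<open>Three generators\<close>

lemma sl_3_generated_by_cyclic_units:
  "lie_generated {axis 1 (axis 2 1), axis 2 (axis 3 1), axis 3 (axis 1 1)}
    = (sl :: ('a::field^3^3) set)"
    (is "lie_generated ?S = _")
proof
  let ?E = "\<lambda>i j. axis i (axis j 1) :: 'a^3^3"
  let ?L = "lie_generated ?S"
  show "?L \<subseteq> sl"
    by (rule lie_generated_subset_sl) (auto intro!: off_diagonal_unit_in_sl)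
  have sub: "matrix_space.subspace ?L"
    using lie_subalgebra_lie_generated[of ?S] by (simp add: lie_subalgebra_def)
  have br: "lie_bracket a b \<in> ?L" if "a \<in> ?L" "b \<in> ?L" for a b
    using lie_subalgebra_lie_generated[of ?S] that by (auto simp: lie_subalgebra_def)
  have gens: "?E 1 2 \<in> ?L" "?E 2 3 \<in> ?L" "?E 3 1 \<in> ?L"
    using subset_lie_generated[of ?S] by auto
  have offs: "?E 1 3 \<in> ?L" "?E 2 1 \<in> ?L" "?E 3 2 \<in> ?L"
    using br[OF gens(1,2)] br[OF gens(2,3)] br[OF gens(3,1)]
    by (simp_all add: lie_bracket_matrix_units)
  have diags: "?E 1 1 - ?E 2 2 \<in> ?L" "?E 2 2 - ?E 3 3 \<in> ?L"
    using br[OF gens(1) offs(2)] br[OF gens(2) offs(3)]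
    by (simp_all add: lie_bracket_matrix_units)
  show "sl \<subseteq> ?L"
  proof
    fix A :: "'a^3^3" assume "A \<in> sl"
    then have A33: "A$3$3 = - A$1$1 - A$2$2"
      by (simp add: sl_def trace_def sum_3 eq_neg_iff_add_eq_0 algebra_simps)
    \<comment> \<open>The partial sums of the diagonal entries are the coefficients of the consecutive differences.\<close>
    have "A = matrix_scale (A$1$2) (?E 1 2) + matrix_scale (A$2$3) (?E 2 3)
      + matrix_scale (A$3$1) (?E 3 1) + matrix_scale (A$1$3) (?E 1 3)
      + matrix_scale (A$2$1) (?E 2 1) + matrix_scale (A$3$2) (?E 3 2)
      + matrix_scale (A$1$1) (?E 1 1 - ?E 2 2)
      + matrix_scale (A$1$1 + A$2$2) (?E 2 2 - ?E 3 3)"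
      by (simp add: vec_eq_iff forall_3 matrix_unit_nth A33)
    also have "\<dots> \<in> ?L"
      by (intro matrix_space.subspace_add[OF sub] matrix_space.subspace_scale[OF sub]
          gens offs diags)
    finally show "A \<in> ?L" .
  qed
qed

theorem theorem6p1:
  assumes "CHAR('a::field) = 3"
  shows "(\<forall>x \<in> (sl :: ('a^3^3) set). \<forall>y \<in> sl. matrix_space.dim (lie_generated {x, y}) \<le> 4)
    \<and> \<not> k_generated 2 (sl :: ('a^3^3) set)
    \<and> k_generated 3 (sl :: ('a^3^3) set)"
proof (intro conjI)
  have three: "(3::'a) = 0"
    using of_nat_CHAR[where 'a='a] assms by simp
  show dim: "\<forall>x \<in> (sl :: ('a^3^3) set). \<forall>y \<in> sl. matrix_space.dim (lie_generated {x, y}) \<le> 4"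
    using dim_lie_generated_pair_le_4[OF three] by (simp add: sl_def)
  show "\<not> k_generated 2 (sl :: ('a^3^3) set)"
  proof
    assume "k_generated 2 (sl :: ('a^3^3) set)"
    then obtain x y :: "'a^3^3" where "x \<in> sl" "y \<in> sl" "lie_generated {x, y} = sl"
      by (auto simp: k_generated_def length_Suc_conv numeral_2_eq_2)
    with dim have "matrix_space.dim (sl :: ('a^3^3) set) \<le> 4"
      by metis
    with dim_sl_ge[where 'a='a and 'n=3] show False
      by simp
  qed
  let ?gens = "[axis 1 (axis 2 1), axis 2 (axis 3 1), axis 3 (axis 1 1)] :: ('a^3^3) list"
  have "set ?gens \<subseteq> sl"
    by (auto intro!: off_diagonal_unit_in_sl)
  moreover have "lie_generated (set ?gens) = sl"
    using sl_3_generated_by_cyclic_units by simp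
  ultimately show "k_generated 3 (sl :: ('a^3^3) set)"
    unfolding k_generated_def by (intro exI[of _ ?gens]) simp
qed

end
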